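(* Let $N \ge 1$ and let $A_L$ and $A_R$ be real $N \times N$ matrices such that $A_R = A_L + \xi e_1^{\sf T}$ for some $\xi \in \mathbb{R}^N$. Suppose that $1$ is not an eigenvalue of $A_L$, of $A_R$, or of $A_R A_L$, and that $-1$ is not an eigenvalue of $A_L$ or of $A_R$. Suppose $$(-1)^{\sigma_L^+ + \sigma_R^+} = (-1)^{\sigma_L^- + \sigma_R^-}.$$ Then $$(-1)^{\sigma_{LL}^+ + \sigma_{LR}^+} = (-1)^{\sigma_L^+ + \sigma_R^+}.$$
   Context: $e_1 \in \mathbb{R}^N$ denotes the first standard basis vector, so $A_L$ and $A_R$ differ only in their first columns. (These matrices arise from the continuous piecewise-linear map $x_{i+1} = A_L x_i + b\mu$ if $e_1^{\sf T} x_i \le 0$, $x_{i+1} = A_R x_i + b\mu$ if $e_1^{\sf T} x_i \ge 0$, with $b \in \mathbb{R}^N$, $\mu \in \mathbb{R}$; continuity of the map is what gives $A_R = A_L + \xi e_1^{\sf T}$.) For $J = L, R$: $\sigma_J^+$ is the number of real eigenvalues of $A_J$ that are greater than $1$, and $\sigma_J^-$ is the number of real eigenvalues of $A_J$ that are less than $-1$. $\sigma_{LR}^+$ is the number of real eigenvalues of $A_R A_L$ (equivalently of $A_L A_R$) that are greater than $1$. $\sigma_{LL}^+$ is the number of real eigenvalues of $A_L^2$ that are greater than $1$. All eigenvalues are counted with algebraic multiplicity. *)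

theory Defs
  imports "Jordan_Normal_Form.Char_Poly"
begin

text \<open>
  Since the matrices are over the reals, \<^term>\<open>eigenvalue A x\<close> ranges exactly over the real
  eigenvalues, and the algebraic multiplicity of such an eigenvalue \<open>x\<close> is its order as a root of the
  characteristic polynomial.  For a square matrix the sums below are over finite sets.
\<close>

definition alg_mult :: "real mat \<Rightarrow> real \<Rightarrow> nat" where
  "alg_mult A x = Polynomial.order x (char_poly A)"

definition sigma_plus :: "real mat \<Rightarrow> nat" where
  "sigma_plus A = (\<Sum>x \<in> {x. eigenvalue A x \<and> x > 1}. alg_mult A x)"

definition sigma_minus :: "real mat \<Rightarrow> nat" where
  "sigma_minus A = (\<Sum>x \<in> {x. eigenvalue A x \<and> x < -1}. alg_mult A x)"

text \<open>Vectors are indexed from \<open>0\<close>, so the first standard basis vector is \<open>unit_vec n 0\<close>.\<close>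

definition outer_prod :: "'a :: semiring_0 vec \<Rightarrow> 'a vec \<Rightarrow> 'a mat" where
  "outer_prod u v = mat (dim_vec u) (dim_vec v) (\<lambda>(i, j). u $ i * v $ j)"

end

theory Submission
  imports Defs
begin

text \<open>
  The statement is about signs of four numbers. For a monic real polynomial \<open>p\<close> with \<open>p(c) \<noteq> 0\<close>, the
  sign of \<open>p(c)\<close> is \<open>(-1)\<close> to the number of real roots above \<open>c\<close>, because each such root contributes a
  negative factor while the remaining cofactor stays positive on \<open>[c, \<infinity>)\<close>. Applied to the
  characteristic polynomial at \<open>1\<close>, and in mirrored form at \<open>-1\<close>, this gives
  \<open>sgn (det (I - A)) = (-1)^(\<sigma>\<^sup>+ A)\<close> and \<open>sgn (det (I + A)) = (-1)^(\<sigma>\<^sup>- A)\<close>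
  (\<open>sgn_det_one_minus\<close>, \<open>sgn_det_one_plus\<close>).

  The two products whose spectra are compared are then reduced to determinants of \<open>I \<plusminus> A\<^sub>L\<close> and
  \<open>I \<plusminus> A\<^sub>R\<close>. Firstly \<open>det (I - A\<^sub>L\<^sup>2) = det (I - A\<^sub>L) * det (I + A\<^sub>L)\<close>. Secondly, writing
  \<open>E = A\<^sub>R - A\<^sub>L\<close> and \<open>M = I - A\<^sub>R A\<^sub>L\<close>, one has \<open>(I - A\<^sub>R)(I + A\<^sub>L) = M - E\<close> and
  \<open>(I + A\<^sub>R)(I - A\<^sub>L) = M + E\<close>. Since \<open>E\<close> lives in a single column, the determinant is affine along
  \<open>t \<mapsto> M + t E\<close>, so
  \<open>2 det M = det (I - A\<^sub>R) det (I + A\<^sub>L) + det (I + A\<^sub>R) det (I - A\<^sub>L)\<close>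
  (\<open>two_det_one_minus_product\<close>).

  The parity hypothesis says that \<open>det (I - A\<^sub>L) det (I - A\<^sub>R)\<close> and \<open>det (I + A\<^sub>L) det (I + A\<^sub>R)\<close> have the
  same sign, that is, the two summands above have the same sign. Hence \<open>det M\<close> has the sign of
  \<open>det (I - A\<^sub>R) det (I + A\<^sub>L)\<close>, and multiplying by \<open>det (I - A\<^sub>L\<^sup>2)\<close> turns this into the sign of
  \<open>det (I - A\<^sub>L) det (I - A\<^sub>R)\<close>.
\<close>

section \<open>Signs of real polynomials and the number of roots on one side\<close>

text \<open>
  Splitting off exactly the roots on one side of a point keeps the argument over the reals: the
  cofactor \<open>q\<close> may still have complex roots, or real ones on the other side, but its sign at the
  point is then decided by its leading coefficient alone.
\<close>

lemma split_off_roots: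
  fixes p :: "'a :: idom poly"
  assumes "p \<noteq> 0"
  shows "\<exists>q. p = (\<Prod>x\<in>#filter_mset P (proots p). [:- x, 1:]) * q \<and> (\<forall>x. poly q x = 0 \<longrightarrow> \<not> P x)"
  using assms
proof (induction "degree p" arbitrary: p rule: less_induct)
  case less
  show ?case
  proof (cases "\<exists>x. poly p x = 0 \<and> P x")
    case False
    then have "filter_mset P (proots p) = {#}"
      using less.prems by (intro Multiset.set_mset_eq_empty_iff[THEN iffD1]) auto
    then have "(\<Prod>x\<in>#filter_mset P (proots p). [:- x, 1:]) = 1"
      by (simp only: image_mset_empty prod_mset_empty)
    then have "p = (\<Prod>x\<in>#filter_mset P (proots p). [:- x, 1:]) * p"
      by (simp only: mult_1_left)
    with False show ?thesis by blast
  next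
    case True
    then obtain x r where x: "P x" and r: "p = [:- x, 1:] * r"
      by (auto simp: poly_eq_0_iff_dvd dvd_def)
    have "r \<noteq> 0" using r less.prems by auto
    moreover have "degree p = Suc (degree r)"
      using \<open>r \<noteq> 0\<close> unfolding r by (subst degree_mult_eq) auto
    ultimately have IH: "\<exists>q. r = (\<Prod>x\<in>#filter_mset P (proots r). [:- x, 1:]) * q
        \<and> (\<forall>x. poly q x = 0 \<longrightarrow> \<not> P x)"
      by (intro less.hyps) auto
    define S where "S = (\<Prod>x\<in>#filter_mset P (proots r). [:- x, 1:])"
    from IH obtain q where q: "r = S * q" "\<forall>x. poly q x = 0 \<longrightarrow> \<not> P x"
      unfolding S_def by blast
    have "proots p = {#x#} + proots r"
      using \<open>r \<noteq> 0\<close> unfolding r by (subst proots_mult) auto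
    then have "(\<Prod>x\<in>#filter_mset P (proots p). [:- x, 1:])
        = [:- x, 1:] * S"
      using x by (simp add: S_def)
    moreover have "p = ([:- x, 1:] * S) * q"
      unfolding r q(1) by (rule mult.assoc[symmetric])
    ultimately show ?thesis
      using q(2) by (intro exI[of _ q]) simp
  qed
qed

text \<open>
  Eventually \<open>p\<close> has the sign of its leading coefficient; by the intermediate value theorem the sign
  cannot change on the way back to \<open>c\<close>.
\<close>

lemma sgn_poly_no_roots_ge:
  fixes p :: "real poly"
  assumes no_root: "\<And>x. x \<ge> c \<Longrightarrow> poly p x \<noteq> 0"
  shows "sgn (poly p c) = sgn (lead_coeff p)"
proof -
  have pos: "poly q c > 0" if lc: "lead_coeff q > 0" and nz: "\<And>x. x \<ge> c \<Longrightarrow> poly q x \<noteq> 0" for q :: "real poly"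
  proof (rule ccontr)
    assume "\<not> poly q c > 0"
    then have neg: "poly q c < 0" using nz[of c] by force
    obtain n where n: "\<forall>x\<ge>n. poly q x \<ge> lead_coeff q"
      using poly_pinfty_gt_lc[OF lc] by blast
    define d where "d = max n (c + 1)"
    have "poly q d > 0" using n[rule_format, of d] lc by (simp add: d_def)
    moreover have "c < d" by (simp add: d_def)
    ultimately obtain x where "c < x" "poly q x = 0"
      using poly_IVT_pos[of c d q] neg by auto
    then show False
      using nz[of x] by simp
  qed
  have "lead_coeff p \<noteq> 0" using no_root[of c] by auto
  then show ?thesis
    using pos[of p] pos[of "- p"] no_root
    by (cases "lead_coeff p" "0 :: real" rule: linorder_cases) auto
qed

text \<open>
  The substitution \<open>x \<mapsto> -x\<close> exchanges the two ends of the line and multiplies the leading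
  coefficient by \<open>(-1) ^ degree p\<close>.
\<close>

lemma sgn_poly_no_roots_le:
  fixes p :: "real poly"
  assumes no_root: "\<And>x. x \<le> c \<Longrightarrow> poly p x \<noteq> 0"
  shows "sgn (poly p c) = (-1) ^ degree p * sgn (lead_coeff p)"
proof -
  define q where "q = pcompose p [:0, - 1:]"
  have "sgn (poly q (- c)) = sgn (lead_coeff q)"
    by (rule sgn_poly_no_roots_ge) (use no_root in \<open>auto simp: q_def poly_pcompose\<close>)
  moreover have "lead_coeff q = lead_coeff p * (-1) ^ degree p"
    unfolding q_def by (subst lead_coeff_comp) auto
  ultimately show ?thesis
    by (simp add: q_def poly_pcompose sgn_mult)
qed

lemma degree_prod_mset_linear:
  "degree (\<Prod>x\<in>#R. [:- x, 1:: 'a :: idom:]) = size R"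
proof (induction R)
  case (add x R)
  have "(\<Prod>x\<in>#R. [:- x, 1:]) \<noteq> 0" by (auto simp: prod_mset_zero_iff)
  with add show ?case by (simp add: degree_mult_eq del: mult_pCons_left)
qed auto

lemma lead_coeff_prod_mset_linear:
  "lead_coeff (\<Prod>x\<in>#R. [:- x, 1:: 'a :: idom:]) = 1"
  by (induction R) (auto simp: lead_coeff_mult simp del: mult_pCons_left)

lemma sgn_poly_prod_mset_greater:
  "\<forall>x\<in>#R. c < x \<Longrightarrow> sgn (poly (\<Prod>x\<in>#R. [:- x, 1:]) c) = (-1) ^ size R" for c :: real
  by (induction R) (auto simp: sgn_mult simp del: mult_pCons_left)

lemma sgn_poly_prod_mset_less:
  "\<forall>x\<in>#R. x < c \<Longrightarrow> sgn (poly (\<Prod>x\<in>#R. [:- x, 1:]) c) = 1" for c :: real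
  by (induction R) (auto simp: sgn_mult simp del: mult_pCons_left)

text \<open>
  Each root \<open>x > c\<close>, with multiplicity, contributes the negative factor \<open>c - x\<close>, and the cofactor is
  positive at \<open>c\<close>.
\<close>

lemma sgn_monic_poly_roots_greater:
  fixes p :: "real poly"
  assumes "lead_coeff p = 1" "poly p c \<noteq> 0"
  shows "sgn (poly p c) = (-1) ^ size {#x \<in># proots p. c < x#}"
proof -
  define R where "R = {#x \<in># proots p. c < x#}"
  have "p \<noteq> 0" using assms by auto
  then obtain q where p: "p = (\<Prod>x\<in>#R. [:- x, 1:]) * q" and q: "\<And>x. poly q x = 0 \<Longrightarrow> \<not> c < x"
    using split_off_roots[of p "\<lambda>x. c < x"] unfolding R_def by blast
  have lc: "lead_coeff q = 1"
    using assms(1) unfolding p by (simp add: lead_coeff_mult lead_coeff_prod_mset_linear)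
  have "poly q c \<noteq> 0" using assms(2) unfolding p by auto
  then have "sgn (poly q c) = 1"
    using q sgn_poly_no_roots_ge[of c q] lc by (metis order_le_less sgn_one)
  moreover have "sgn (poly (\<Prod>x\<in>#R. [:- x, 1:]) c) = (-1) ^ size R"
    by (rule sgn_poly_prod_mset_greater) (auto simp: R_def)
  ultimately show ?thesis
    unfolding R_def[symmetric] by (subst p) (simp add: sgn_mult)
qed

text \<open>
  Here the factors \<open>c - x\<close> are positive, and the sign comes from the cofactor, whose degree is
  \<open>degree p\<close> minus the number of roots below \<open>c\<close>.
\<close>

lemma sgn_monic_poly_roots_less:
  fixes p :: "real poly"
  assumes "lead_coeff p = 1" "poly p c \<noteq> 0"
  shows "sgn (poly p c) = (-1) ^ degree p * (-1) ^ size {#x \<in># proots p. x < c#}"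
proof -
  define R where "R = {#x \<in># proots p. x < c#}"
  have "p \<noteq> 0" using assms by auto
  then obtain q where p: "p = (\<Prod>x\<in>#R. [:- x, 1:]) * q" and q: "\<And>x. poly q x = 0 \<Longrightarrow> \<not> x < c"
    using split_off_roots[of p "\<lambda>x. x < c"] unfolding R_def by blast
  have lc: "lead_coeff q = 1"
    using assms(1) unfolding p by (simp add: lead_coeff_mult lead_coeff_prod_mset_linear)
  have "poly q c \<noteq> 0" using assms(2) unfolding p by auto
  then have "sgn (poly q c) = (-1) ^ degree q"
    using q sgn_poly_no_roots_le[of c q] lc by (metis order_le_less sgn_one mult.right_neutral)
  moreover have "sgn (poly (\<Prod>x\<in>#R. [:- x, 1:]) c) = 1"
    by (rule sgn_poly_prod_mset_less) (auto simp: R_def)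
  moreover have "degree p = size R + degree q"
    using \<open>p \<noteq> 0\<close> unfolding p by (subst degree_mult_eq) (auto simp: degree_prod_mset_linear)
  ultimately show ?thesis
    unfolding R_def[symmetric] by (subst p) (simp add: sgn_mult power_add mult_ac flip: power_mult_distrib)
qed

lemma size_filter_proots:
  fixes p :: "'a :: idom poly"
  assumes "p \<noteq> 0"
  shows "size (filter_mset P (proots p)) = (\<Sum>x | poly p x = 0 \<and> P x. order x p)"
proof -
  have "set_mset (filter_mset P (proots p)) = {x. poly p x = 0 \<and> P x}"
    using assms by auto
  then show ?thesis
    using assms by (auto simp: size_multiset_overloaded_eq intro!: sum.cong)
qed

section \<open>Signs of determinants and the number of eigenvalues beyond plus or minus one\<close>

lemma sgn_det_one_minus:
  assumes A: "A \<in> carrier_mat n n" and "\<not> eigenvalue A 1"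
  shows "sgn (det (1\<^sub>m n - A)) = (-1) ^ sigma_plus A"
proof -
  have monic: "lead_coeff (char_poly A) = 1" using degree_monic_char_poly[OF A] by auto
  then have "char_poly A \<noteq> 0" by auto
  then have "sigma_plus A = size {#x \<in># proots (char_poly A). 1 < x#}"
    by (simp add: size_filter_proots sigma_plus_def alg_mult_def eigenvalue_root_char_poly[OF A])
  moreover have "poly (char_poly A) 1 \<noteq> 0" using assms by (simp add: eigenvalue_root_char_poly)
  moreover have "- char_matrix A 1 = 1\<^sub>m n - A"
    using A by (intro eq_matI) (auto simp: char_matrix_def)
  ultimately show ?thesis
    using sgn_monic_poly_roots_greater[OF monic, of 1] char_poly_matrix[OF A, of 1] by simp
qed

text \<open>
  The characteristic polynomial at \<open>-1\<close> is \<open>det (- I - A) = (-1)^n det (I + A)\<close>; this power of \<open>-1\<close>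
  cancels the one that a polynomial of degree \<open>n\<close> has at the negative end of the line.
\<close>

lemma sgn_det_one_plus:
  assumes A: "A \<in> carrier_mat n n" and "\<not> eigenvalue A (-1)"
  shows "sgn (det (1\<^sub>m n + A)) = (-1) ^ sigma_minus A"
proof -
  have monic: "lead_coeff (char_poly A) = 1" and deg: "degree (char_poly A) = n"
    using degree_monic_char_poly[OF A] by auto
  then have "char_poly A \<noteq> 0" by auto
  then have "sigma_minus A = size {#x \<in># proots (char_poly A). x < - 1#}"
    by (simp add: size_filter_proots sigma_minus_def alg_mult_def eigenvalue_root_char_poly[OF A])
  moreover have "poly (char_poly A) (- 1) \<noteq> 0" using assms by (simp add: eigenvalue_root_char_poly)
  moreover have "- char_matrix A (- 1) = (- 1) \<cdot>\<^sub>m (1\<^sub>m n + A)"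
    using A by (intro eq_matI) (auto simp: char_matrix_def)
  then have "poly (char_poly A) (- 1) = (- 1) ^ n * det (1\<^sub>m n + A)"
    using A char_poly_matrix[OF A, of "- 1"] by (simp add: det_smult)
  ultimately show ?thesis
    using sgn_monic_poly_roots_less[OF monic, of "- 1"] deg by (simp add: sgn_mult)
qed

section \<open>The determinant of a product of matrices that differ in one column\<close>

text \<open>
  In the Laplace expansion along the first column the cofactors do not see the perturbation, so the
  determinant is affine in it.
\<close>

lemma det_first_column_midpoint:
  fixes M :: "'a :: comm_ring_1 mat"
  assumes M: "M \<in> carrier_mat n n" and v: "v \<in> carrier_vec n" and "n > 0"
  shows "det (M + outer_prod v (unit_vec n 0)) + det (M - outer_prod v (unit_vec n 0)) = 2 * det M"
proof -
  let ?E = "outer_prod v (unit_vec n 0)"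
  have E: "?E \<in> carrier_mat n n" using v by (simp add: outer_prod_def)
  have E0: "?E $$ (i, 0) = v $ i" if "i < n" for i
    using that v \<open>n > 0\<close> by (simp add: outer_prod_def)
  have cof: "cofactor (M + ?E) i 0 = cofactor M i 0" "cofactor (M - ?E) i 0 = cofactor M i 0"
    if "i < n" for i
  proof -
    have "mat_delete (M + ?E) i 0 = mat_delete M i 0" "mat_delete (M - ?E) i 0 = mat_delete M i 0"
      using that M v by (auto intro!: eq_matI simp: mat_delete_def outer_prod_def)
    then show "cofactor (M + ?E) i 0 = cofactor M i 0" "cofactor (M - ?E) i 0 = cofactor M i 0"
      by (simp_all add: cofactor_def)
  qed
  have "det (M + ?E) = (\<Sum>i<n. (M $$ (i, 0) + v $ i) * cofactor M i 0)"
    using laplace_expansion_column[of "M + ?E" n 0] M E E0 \<open>n > 0\<close> cof by simp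
  moreover have "det (M - ?E) = (\<Sum>i<n. (M $$ (i, 0) - v $ i) * cofactor M i 0)"
    using laplace_expansion_column[OF minus_carrier_mat[OF E], of 0 M] M E E0 \<open>n > 0\<close> cof by simp
  moreover have "det M = (\<Sum>i<n. M $$ (i, 0) * cofactor M i 0)"
    using laplace_expansion_column[of M n 0] M \<open>n > 0\<close> by simp
  ultimately show ?thesis
    by (simp add: sum_distrib_left algebra_simps flip: sum.distrib)
qed

lemma one_minus_times_one_plus:
  fixes A B :: "'a :: comm_ring_1 mat"
  assumes A: "A \<in> carrier_mat n n" and B: "B \<in> carrier_mat n n"
  shows "(1\<^sub>m n - B) * (1\<^sub>m n + A) = (1\<^sub>m n - B * A) - (B - A)"
    and "(1\<^sub>m n + B) * (1\<^sub>m n - A) = (1\<^sub>m n - B * A) + (B - A)"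
proof -
  have BA: "B * A \<in> carrier_mat n n" using A B by simp
  have "(1\<^sub>m n - B) * (1\<^sub>m n + A) = (1\<^sub>m n + A) - (B + B * A)"
    using A B by (simp add: minus_mult_distrib_mat[of _ n n _ _ n] mult_add_distrib_mat[of _ n n _ n])
  also have "\<dots> = (1\<^sub>m n - B * A) - (B - A)"
    using A B BA by (intro eq_matI) (auto simp: algebra_simps simp del: index_mult_mat(1))
  finally show "(1\<^sub>m n - B) * (1\<^sub>m n + A) = (1\<^sub>m n - B * A) - (B - A)" .
  have "(1\<^sub>m n + B) * (1\<^sub>m n - A) = (1\<^sub>m n - A) + (B - B * A)"
    using A B by (subst add_mult_distrib_mat[of _ n n _ _ n])
      (simp_all add: mult_minus_distrib_mat[of _ n n _ n] minus_carrier_mat)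
  also have "\<dots> = (1\<^sub>m n - B * A) + (B - A)"
    using A B BA by (intro eq_matI) (auto simp: algebra_simps simp del: index_mult_mat(1))
  finally show "(1\<^sub>m n + B) * (1\<^sub>m n - A) = (1\<^sub>m n - B * A) + (B - A)" .
qed

text \<open>
  The two products \<open>(I - B)(I + A)\<close> and \<open>(I + B)(I - A)\<close> are \<open>I - B A\<close> perturbed by \<open>-(B - A)\<close> and
  \<open>+(B - A)\<close>, so \<open>I - B A\<close> is the midpoint of a segment on which the determinant is affine.
\<close>

lemma two_det_one_minus_product:
  fixes A B :: "'a :: comm_ring_1 mat"
  assumes A: "A \<in> carrier_mat n n" and v: "v \<in> carrier_vec n" and "n > 0"
    and B: "B = A + outer_prod v (unit_vec n 0)"
  shows "2 * det (1\<^sub>m n - B * A)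
       = det (1\<^sub>m n - B) * det (1\<^sub>m n + A) + det (1\<^sub>m n + B) * det (1\<^sub>m n - A)"
proof -
  have E: "outer_prod v (unit_vec n 0) \<in> carrier_mat n n" using v by (simp add: outer_prod_def)
  then have Bc: "B \<in> carrier_mat n n" using A B by simp
  have "B - A = outer_prod v (unit_vec n 0)" unfolding B using A E by (intro eq_matI) auto
  moreover have "1\<^sub>m n - B * A \<in> carrier_mat n n" using A Bc by auto
  moreover have "det (1\<^sub>m n - B) * det (1\<^sub>m n + A) = det ((1\<^sub>m n - B) * (1\<^sub>m n + A))"
    "det (1\<^sub>m n + B) * det (1\<^sub>m n - A) = det ((1\<^sub>m n + B) * (1\<^sub>m n - A))"
    using A Bc by (auto intro!: det_mult[symmetric])
  ultimately show ?thesis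
    using det_first_column_midpoint[OF _ v \<open>n > 0\<close>, of "1\<^sub>m n - B * A"]
    by (simp add: one_minus_times_one_plus[OF A Bc] add.commute)
qed

lemma det_one_minus_square:
  fixes A :: "'a :: comm_ring_1 mat"
  assumes A: "A \<in> carrier_mat n n"
  shows "det (1\<^sub>m n - A ^\<^sub>m 2) = det (1\<^sub>m n - A) * det (1\<^sub>m n + A)"
proof -
  have "A ^\<^sub>m 2 = A * A" using A by (simp add: numeral_2_eq_2)
  moreover have "(1\<^sub>m n - A * A) - (A - A) = 1\<^sub>m n - A * A"
    using A by (intro eq_matI) (auto simp del: index_mult_mat(1))
  ultimately show ?thesis
    using det_mult[of "1\<^sub>m n - A" n "1\<^sub>m n + A"] A by (simp add: one_minus_times_one_plus(1)[OF A A] minus_carrier_mat)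
qed

section \<open>The parity identity\<close>

lemma eigenvalue_one_iff_det:
  fixes A :: "'a :: field mat"
  assumes A: "A \<in> carrier_mat n n"
  shows "eigenvalue A 1 \<longleftrightarrow> det (1\<^sub>m n - A) = 0"
proof -
  have "- char_matrix A 1 = 1\<^sub>m n - A"
    using A by (intro eq_matI) (auto simp: char_matrix_def)
  then show ?thesis
    by (simp add: eigenvalue_root_char_poly[OF A] char_poly_matrix[OF A])
qed

lemma sgn_midpoint:
  fixes m x y :: real
  assumes "2 * m = x + y" "sgn x = sgn y"
  shows "sgn m = sgn x"
proof (cases x "0 :: real" rule: linorder_cases)
  case less
  then have "y < 0" using assms(2) by (metis sgn_less)
  with less assms(1) show ?thesis by simp
next
  case equal
  then have "y = 0" using assms(2) by (metis sgn_0_0)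
  with equal assms(1) show ?thesis by simp
next
  case greater
  then have "y > 0" using assms(2) by (metis sgn_greater)
  with greater assms(1) show ?thesis by simp
qed

theorem theorem5p1:
  fixes N :: nat and A\<^sub>L A\<^sub>R :: "real mat" and \<xi> :: "real vec"
  assumes "N \<ge> 1"
    and "A\<^sub>L \<in> carrier_mat N N" and "A\<^sub>R \<in> carrier_mat N N" and "\<xi> \<in> carrier_vec N"
    and "A\<^sub>R = A\<^sub>L + outer_prod \<xi> (unit_vec N 0)"
    and "\<not> eigenvalue A\<^sub>L 1" and "\<not> eigenvalue A\<^sub>R 1" and "\<not> eigenvalue (A\<^sub>R * A\<^sub>L) 1"
    and "\<not> eigenvalue A\<^sub>L (-1)" and "\<not> eigenvalue A\<^sub>R (-1)"
    and "(-1 :: int) ^ (sigma_plus A\<^sub>L + sigma_plus A\<^sub>R)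
       = (-1) ^ (sigma_minus A\<^sub>L + sigma_minus A\<^sub>R)"
  shows "(-1 :: int) ^ (sigma_plus (A\<^sub>L ^\<^sub>m 2) + sigma_plus (A\<^sub>R * A\<^sub>L))
       = (-1) ^ (sigma_plus A\<^sub>L + sigma_plus A\<^sub>R)"
proof -
  note L = assms(2)
  define a where "a = det (1\<^sub>m N - A\<^sub>L)"
  define b where "b = det (1\<^sub>m N + A\<^sub>L)"
  define c where "c = det (1\<^sub>m N - A\<^sub>R)"
  define d where "d = det (1\<^sub>m N + A\<^sub>R)"
  define m where "m = det (1\<^sub>m N - A\<^sub>R * A\<^sub>L)"
  have sgn_a: "sgn a = (-1) ^ sigma_plus A\<^sub>L" and sgn_b: "sgn b = (-1) ^ sigma_minus A\<^sub>L"
    and sgn_c: "sgn c = (-1) ^ sigma_plus A\<^sub>R" and sgn_d: "sgn d = (-1) ^ sigma_minus A\<^sub>R"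
    unfolding a_def b_def c_def d_def
    using assms by (auto intro: sgn_det_one_minus sgn_det_one_plus)
  have sgn_m: "sgn m = (-1) ^ sigma_plus (A\<^sub>R * A\<^sub>L)"
    unfolding m_def using assms by (intro sgn_det_one_minus) auto
  have "a \<noteq> 0" "b \<noteq> 0"
    using sgn_a sgn_b by (metis power_eq_0_iff sgn_0 zero_neq_neg_one)+
  then have "\<not> eigenvalue (A\<^sub>L ^\<^sub>m 2) 1"
    using L by (simp add: eigenvalue_one_iff_det[of _ N] det_one_minus_square a_def b_def)
  then have sgn_ab: "sgn (a * b) = (-1) ^ sigma_plus (A\<^sub>L ^\<^sub>m 2)"
    unfolding a_def b_def det_one_minus_square[OF L, symmetric] using L
    by (intro sgn_det_one_minus) auto

  have same: "sgn (a * c) = sgn (b * d)"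
    using assms(11) unfolding sgn_mult sgn_a sgn_b sgn_c sgn_d
    by (simp add: minus_one_power_iff flip: power_add split: if_splits)
  have "2 * m = c * b + d * a"
    unfolding a_def b_def c_def d_def m_def
    using assms by (intro two_det_one_minus_product) auto
  \<comment> \<open>The two summands have product \<open>(a c)(b d) > 0\<close>, so neither can cancel the other.\<close>
  moreover have "sgn (c * b) = sgn (d * a)"
    using same \<open>a \<noteq> 0\<close> \<open>b \<noteq> 0\<close> by (auto simp: sgn_if zero_less_mult_iff split: if_splits)
  ultimately have "sgn m = sgn (c * b)"
    by (rule sgn_midpoint)
  then have "sgn (a * b) * sgn m = sgn (a * c) * (sgn b * sgn b)"
    by (simp add: sgn_mult mult_ac)
  also have "sgn b * sgn b = 1"
    using \<open>b \<noteq> 0\<close> by (simp add: sgn_if)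
  finally have "sgn (a * b) * sgn m = sgn (a * c)" by simp
  then have "(-1 :: real) ^ (sigma_plus (A\<^sub>L ^\<^sub>m 2) + sigma_plus (A\<^sub>R * A\<^sub>L))
       = (-1) ^ (sigma_plus A\<^sub>L + sigma_plus A\<^sub>R)"
    unfolding sgn_ab sgn_m by (simp add: sgn_mult sgn_a sgn_c power_add)
  then show ?thesis
    by (simp add: minus_one_power_iff split: if_splits)
qed

end
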